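(* Suppose that the column-and-constraint generation (CCG) procedure described in the context terminates at the $R$-th iteration with optimal solutions $(\hat{\boldsymbol{\beta}}^R,\hat{\mathbf{g}}^R,\hat\lambda^R,\{\hat{\mathbf{u}}^j\}_{j=1,\dots,R})$ of the master problem with scenarios $\mathbf{z}^1,\dots,\mathbf{z}^R$. Re-solve this master problem with the variables $\mathbf{g}$ and $\mathbf{u}^j$ fixed at $\hat{\mathbf{g}}^R$ and $\hat{\mathbf{u}}^j$ ($j=1,\dots,R$), respectively, i.e. consider the linear program in $(\boldsymbol{\beta},\lambda)$ $$\min_{\boldsymbol{\beta}\ge0,\ \lambda\in\mathbb{R}}\ \sum_{t\in\mathcal{T}}\sum_{(m,n)\in\mathcal{E}}(\mu^{max}_{mn,t}-1)\beta_{mn,t}+\lambda\quad\text{s.t.}\quad \lambda\ge\sum_{t\in\mathcal{T}}\sum_{n\in\mathcal{N}}\hat s^{\,j}_{nt}+\sum_{t\in\mathcal{T}}\sum_{(m,n)\in\mathcal{E}}z^j_{mn,t}\beta_{mn,t},\quad j=1,\dots,R,$$ where $\hat{\mathbf{s}}^j$ is the load-shedding component of $\hat{\mathbf{u}}^j$. Then the dual optimal solutions $\{\psi_j\}_{j=1,\dots,R}$ associated with the $R$ constraints of this linear program characterize the worst-case contingency probability distribution (that is, a maximizer of $E_{\mathbb{P}}[Q(\hat{\mathbf{g}}^R,\mathbf{z})]$ over $\mathbb{P}\in\mathscr{D}$), i.e., $\mathbb{P}\{\mathbf{z}=\mathbf{z}^j\}=\psi_j$ for all $j=1,\dots,R$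.
   Context: **Data.** $\mathcal{T}=\{1,\dots,T\}$ is a finite set of time periods. $G=(\mathcal{N},\mathcal{E})$ is a finite directed graph (nodes and candidate lines), and $\mathcal{R}\subset\mathcal{N}$ is the set of substation nodes. Let $s\notin\mathcal{N}$ be an extra node, $\mathcal{N}'=\mathcal{N}\cup\{s\}$, $\mathcal{E}'=\mathcal{E}\cup\{(s,r):r\in\mathcal{R}\}$. The following are given real parameters: $B_w,B_y,N_z\ge 0$; line costs $c_{mn}$; resistances $\phi_{mn}$ and reactances $\eta_{mn}$; flow limits $K_{mn},R_{mn}\ge0$; loads $D^p_{nt},D^q_{nt}\ge 0$; capacities $C^p_n,C^q_n\ge0$; voltage bounds $\nu^{min}\le\nu^{max}$ and reference voltage $V_0>0$; failure-rate bounds $\mu^{max}_{mn,t}\ge 0$; integer minimum restoration times $\tau^{rst}_{mn}$. **First-stage set.** $\mathcal{G}$ is the set of $\mathbf{g}=(\mathbf{y},\mathbf{w},\mathbf{f})$ with $y_{mn}\in\{0,1\}$ and $f_{mn}\ge0$ for $(m,n)\in\mathcal{E}'$, and $w_n\in\{0,1\}$ for $n\in\mathcal{N}$, such that - $\sum_{n:(s,n)\in\mathcal{E}'}f_{sn}=|\mathcal{N}'|-1$; - $\sum_{m:(m,n)\in\mathcal{E}'}f_{mn}-\sum_{m:(n,m)\in\mathcal{E}'}f_{nm}=1$ for all $n\in\mathcal{N}'\setminus\{s\}$; - $\sum_{(m,n)\in\mathcal{E}'}y_{mn}=|\mathcal{N}'|-1$; - $f_{mn}\le(|\mathcal{N}'|-1)y_{mn}$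 for all $(m,n)\in\mathcal{E}'$; - $y_{mn}=1$ for all $(m,n)\in\mathcal{E}'\setminus\mathcal{E}$; - $\sum_{n\in\mathcal{N}}w_n\le B_w$ and $\sum_{(m,n)\in\mathcal{E}}c_{mn}y_{mn}\le B_y$. **Contingency scenarios.** The requirement that only constructed lines can fail is relaxed, so the scenario set does not depend on $\mathbf{g}$: $\mathfrak{D}$ is the set of $\mathbf{z}=(z_{mn,t})\in\{0,1\}^{\mathcal{E}\times\mathcal{T}}$ such that $\sum_{(m,n)\in\mathcal{E}}(1-z_{mn,t})\le N_z$ for all $t\in\mathcal{T}$, and $z_{mn,t+\tau}\le z_{mn,t}$ for all $(m,n)\in\mathcal{E}$ and all integers $1\le\tau\le\tau^{rst}_{mn}$ with $t,t+\tau\in\mathcal{T}$. **Second stage.** $Q(\mathbf{g},\mathbf{z})=\min\sum_{t\in\mathcal{T}}\sum_{n\in\mathcal{N}}s_{nt}$ over $\mathbf{u}=(\mathbf{p},\mathbf{q},\mathbf{x}^p,\mathbf{x}^q,\boldsymbol{\nu},\mathbf{s})\in\mathcal{H}(\mathbf{g},\mathbf{z})$, where $\mathcal{H}(\mathbf{g},\mathbf{z})$ is the set of real vectors $\mathbf{u}$ satisfying, for all $t\in\mathcal{T}$: - $\sum_{k:(n,k)\in\mathcal{E}}p_{nk,t}=\sum_{m:(m,n)\in\mathcal{E}}p_{mn,t}-D^p_{nt}+x^p_{nt}+s_{nt}$ for all $n\in\mathcal{N}$; - $\sum_{k:(n,k)\in\mathcal{E}}q_{nk,t}=\sum_{m:(m,n)\in\mathcal{E}}q_{mn,t}-D^q_{nt}+x^q_{nt}$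 for all $n\in\mathcal{N}$; - $\nu_{nt}y_{mn}=\nu_{mt}y_{mn}-(\phi_{mn}p_{mn,t}+\eta_{mn}q_{mn,t})/V_0$ for all $(m,n)\in\mathcal{E}$; - $\nu^{min}\le\nu_{nt}\le\nu^{max}$ for all $n\in\mathcal{N}$; - $0\le p_{mn,t}\le K_{mn}z_{mn,t}y_{mn}$ and $0\le q_{mn,t}\le R_{mn}z_{mn,t}y_{mn}$ for all $(m,n)\in\mathcal{E}$; - $0\le x^p_{nt}\le C^p_n$ and $0\le x^q_{nt}\le C^q_n$ for $n\in\mathcal{R}$; - $0\le x^p_{nt}\le w_nC^p_n$ and $0\le x^q_{nt}\le w_nC^q_n$ for $n\in\mathcal{N}\setminus\mathcal{R}$; - $0\le s_{nt}\le D^p_{nt}$ for all $n\in\mathcal{N}$. Standing assumption: this minimization is always feasible and bounded, so $Q(\mathbf{g},\mathbf{z})$ is a finite real number for all $\mathbf{g}\in\mathcal{G}$, $\mathbf{z}\in\mathfrak{D}$. **Ambiguity set.** $\mathscr{D}$ is the set of all probability distributions $\mathbb{P}$ on the finite set $\mathfrak{D}$ such that $0\le E_{\mathbb{P}}[1-z_{mn,t}]\le\mu^{max}_{mn,t}$ for all $(m,n)\in\mathcal{E}$, $t\in\mathcal{T}$. **Full problem.** $$\min_{\boldsymbol{\beta}\ge0,\ \mathbf{g}\in\mathcal{G}}\ \max_{\mathbf{z}\in\mathfrak{D}}\ \Bigl\{Q(\mathbf{g},\mathbf{z})+\sum_{t\in\mathcal{T}}\sum_{(m,n)\in\mathcal{E}}(\mu^{max}_{mn,t}+z_{mn,t}-1)\beta_{mn,t}\Bigr\},$$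 an equivalent reformulation of $\min_{\mathbf{g}\in\mathcal{G}}\max_{\mathbb{P}\in\mathscr{D}}E_{\mathbb{P}}[Q(\mathbf{g},\mathbf{z})]$. **Master problem with scenarios $\mathbf{z}^1,\dots,\mathbf{z}^r\in\mathfrak{D}$ (iteration $r$).** $$\min_{\boldsymbol{\beta}\ge0,\ \mathbf{g}\in\mathcal{G},\ \lambda\in\mathbb{R},\ \mathbf{u}^1,\dots,\mathbf{u}^r}\ \sum_{t\in\mathcal{T}}\sum_{(m,n)\in\mathcal{E}}(\mu^{max}_{mn,t}-1)\beta_{mn,t}+\lambda$$ subject to $\lambda\ge\sum_{t\in\mathcal{T}}\sum_{n\in\mathcal{N}}s^j_{nt}+\sum_{t\in\mathcal{T}}\sum_{(m,n)\in\mathcal{E}}z^j_{mn,t}\beta_{mn,t}$ and $\mathbf{u}^j\in\mathcal{H}(\mathbf{g},\mathbf{z}^j)$ for $j=1,\dots,r$, where $\mathbf{s}^j$ is the load-shedding component of $\mathbf{u}^j$. Its optimal value is a lower bound on that of the full problem. **CCG procedure.** Pick an optimality tolerance $\epsilon$. Start with $LB=-\infty$, $UB=+\infty$, and an empty scenario list. In each iteration: (1) solve the master problem over the current scenarios, giving an optimal solution with components $(\hat{\boldsymbol{\beta}},\hat{\mathbf{g}})$, and set $LB$ to its optimal value; (2) solve the subproblem $\max_{\mathbf{z}\in\mathfrak{D}}\{Q(\hat{\mathbf{g}},\mathbf{z})+\sum_{t\in\mathcal{T}}\sum_{(m,n)\in\mathcal{E}}\hat\beta_{mn,t}z_{mn,t}\}$,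 giving its optimal value $objSP$ and an optimal scenario $\hat{\mathbf{z}}$, set $UB=\min\{UB,\ objSP+\sum_{t\in\mathcal{T}}\sum_{(m,n)\in\mathcal{E}}(\mu^{max}_{mn,t}-1)\hat\beta_{mn,t}\}$, and add $\hat{\mathbf{z}}$ to the scenario list; (3) if $(UB-LB)/LB\le\epsilon$, terminate and output the current $\hat{\mathbf{g}}$ as an optimal solution; otherwise create new second-stage variables $\mathbf{u}$ with the constraint $\mathbf{u}\in\mathcal{H}(\mathbf{g},\hat{\mathbf{z}})$, add them (with the corresponding $\lambda$-constraint) to the master problem, and repeat. In the claim, $\mathbf{z}^1,\dots,\mathbf{z}^R$ are the scenarios in the master problem at termination, and $(\hat{\boldsymbol{\beta}}^R,\hat{\mathbf{g}}^R,\hat\lambda^R,\{\hat{\mathbf{u}}^j\}_{j=1,\dots,R})$ is an optimal solution of that master problem.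
   Formalization: If UB>LB, ψ is a maximizer only up to UB−LB; ĝ^R is assumed to have full-problem value ≤UB; û^j must attain Q(ĝ^R,z^j) where ψ_j>0, else only some dual optimal ψ works; unbounded masters give LB=−∞; scenarios are not repeated; at LB=0 the test requires UB=0. *)

theory Defs
  imports "HOL-Probability.Probability"
begin

section \<open>Problem data\<close>

record 'n planning =
  horizon :: nat
  nodes :: "'n set"
  lines :: "('n \<times> 'n) set"
  substations :: "'n set"
  source :: 'n                            \<comment> \<open>the extra node \<open>s\<close>\<close>
  placement_budget :: real                \<comment> \<open>\<open>B_w\<close>\<close>
  line_budget :: real                     \<comment> \<open>\<open>B_y\<close>\<close>
  failure_budget :: real                  \<comment> \<open>\<open>N_z\<close>\<close>
  line_cost :: "'n \<times> 'n \<Rightarrow> real"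
  resistance :: "'n \<times> 'n \<Rightarrow> real"
  reactance :: "'n \<times> 'n \<Rightarrow> real"
  p_limit :: "'n \<times> 'n \<Rightarrow> real"           \<comment> \<open>\<open>K\<close>\<close>
  q_limit :: "'n \<times> 'n \<Rightarrow> real"           \<comment> \<open>\<open>R\<close>\<close>
  p_load :: "'n \<Rightarrow> nat \<Rightarrow> real"
  q_load :: "'n \<Rightarrow> nat \<Rightarrow> real"
  p_capacity :: "'n \<Rightarrow> real"
  q_capacity :: "'n \<Rightarrow> real"
  v_min :: real
  v_max :: real
  v_ref :: real
  failure_rate :: "('n \<times> 'n) \<times> nat \<Rightarrow> real"   \<comment> \<open>\<open>\<mu>\<close> with superscript max\<close>
  restore_time :: "'n \<times> 'n \<Rightarrow> int"

definition periods :: "'n planning \<Rightarrow> nat set" where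
  "periods I = {1..horizon I}"

definition nodes' :: "'n planning \<Rightarrow> 'n set" where
  "nodes' I = insert (source I) (nodes I)"

definition lines' :: "'n planning \<Rightarrow> ('n \<times> 'n) set" where
  "lines' I = lines I \<union> {source I} \<times> substations I"

definition valid_planning :: "'n planning \<Rightarrow> bool" where
  "valid_planning I \<longleftrightarrow>
     finite (nodes I) \<and> lines I \<subseteq> nodes I \<times> nodes I \<and> substations I \<subseteq> nodes I \<and>
     source I \<notin> nodes I \<and>
     0 \<le> placement_budget I \<and> 0 \<le> line_budget I \<and> 0 \<le> failure_budget I \<and>
     (\<forall>e\<in>lines I. 0 \<le> p_limit I e \<and> 0 \<le> q_limit I e) \<and>
     (\<forall>n\<in>nodes I. \<forall>t\<in>periods I. 0 \<le> p_load I n t \<and> 0 \<le> q_load I n t) \<and>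
     (\<forall>n\<in>nodes I. 0 \<le> p_capacity I n \<and> 0 \<le> q_capacity I n) \<and>
     v_min I \<le> v_max I \<and> 0 < v_ref I \<and>
     (\<forall>e\<in>lines I. \<forall>t\<in>periods I. 0 \<le> failure_rate I (e, t))"

section \<open>First stage, scenarios, second stage\<close>

record 'n first_stage =
  build :: "'n \<times> 'n \<Rightarrow> real"     \<comment> \<open>\<open>y\<close>\<close>
  place :: "'n \<Rightarrow> real"          \<comment> \<open>\<open>w\<close>\<close>
  flow :: "'n \<times> 'n \<Rightarrow> real"      \<comment> \<open>\<open>f\<close>\<close>

definition first_stage_set :: "'n planning \<Rightarrow> 'n first_stage set" where
  "first_stage_set I = {g.
     (\<forall>e\<in>lines' I. build g e \<in> {0, 1} \<and> 0 \<le> flow g e) \<and>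
     (\<forall>n\<in>nodes I. place g n \<in> {0, 1}) \<and>
     (\<Sum>n | (source I, n) \<in> lines' I. flow g (source I, n)) = real (card (nodes' I)) - 1 \<and>
     (\<forall>n \<in> nodes' I - {source I}.
        (\<Sum>m | (m, n) \<in> lines' I. flow g (m, n)) - (\<Sum>m | (n, m) \<in> lines' I. flow g (n, m)) = 1) \<and>
     (\<Sum>e\<in>lines' I. build g e) = real (card (nodes' I)) - 1 \<and>
     (\<forall>e\<in>lines' I. flow g e \<le> (real (card (nodes' I)) - 1) * build g e) \<and>
     (\<forall>e \<in> lines' I - lines I. build g e = 1) \<and>
     (\<Sum>n\<in>nodes I. place g n) \<le> placement_budget I \<and>
     (\<Sum>e\<in>lines I. line_cost I e * build g e) \<le> line_budget I}"

text \<open>A scenario is an extensional function, so that the set of scenarios is finite and two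
  scenarios are equal iff their entries on lines and periods agree.\<close>

type_synonym 'n scenario = "('n \<times> 'n) \<times> nat \<Rightarrow> real"

definition scenarios :: "'n planning \<Rightarrow> 'n scenario set" where
  "scenarios I = {z \<in> (lines I \<times> periods I) \<rightarrow>\<^sub>E {0, 1}.
     (\<forall>t\<in>periods I. (\<Sum>e\<in>lines I. 1 - z (e, t)) \<le> failure_budget I) \<and>
     (\<forall>e\<in>lines I. \<forall>t\<in>periods I. \<forall>k::nat.
        1 \<le> k \<and> int k \<le> restore_time I e \<and> t + k \<in> periods I \<longrightarrow> z (e, t + k) \<le> z (e, t))}"

record 'n second_stage =
  p_flow :: "'n \<times> 'n \<Rightarrow> nat \<Rightarrow> real"
  q_flow :: "'n \<times> 'n \<Rightarrow> nat \<Rightarrow> real"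
  p_inject :: "'n \<Rightarrow> nat \<Rightarrow> real"
  q_inject :: "'n \<Rightarrow> nat \<Rightarrow> real"
  voltage :: "'n \<Rightarrow> nat \<Rightarrow> real"
  shed :: "'n \<Rightarrow> nat \<Rightarrow> real"

definition second_stage_set ::
    "'n planning \<Rightarrow> 'n first_stage \<Rightarrow> 'n scenario \<Rightarrow> 'n second_stage set" where
  "second_stage_set I g z = {u. \<forall>t\<in>periods I.
     (\<forall>n\<in>nodes I.
        (\<Sum>k | (n, k) \<in> lines I. p_flow u (n, k) t) =
        (\<Sum>m | (m, n) \<in> lines I. p_flow u (m, n) t) - p_load I n t + p_inject u n t + shed u n t) \<and>
     (\<forall>n\<in>nodes I.
        (\<Sum>k | (n, k) \<in> lines I. q_flow u (n, k) t) =
        (\<Sum>m | (m, n) \<in> lines I. q_flow u (m, n) t) - q_load I n t + q_inject u n t) \<and>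
     (\<forall>(m, n) \<in> lines I.
        voltage u n t * build g (m, n) =
        voltage u m t * build g (m, n) -
          (resistance I (m, n) * p_flow u (m, n) t + reactance I (m, n) * q_flow u (m, n) t) / v_ref I) \<and>
     (\<forall>n\<in>nodes I. v_min I \<le> voltage u n t \<and> voltage u n t \<le> v_max I) \<and>
     (\<forall>e\<in>lines I.
        0 \<le> p_flow u e t \<and> p_flow u e t \<le> p_limit I e * z (e, t) * build g e \<and>
        0 \<le> q_flow u e t \<and> q_flow u e t \<le> q_limit I e * z (e, t) * build g e) \<and>
     (\<forall>n\<in>substations I.
        0 \<le> p_inject u n t \<and> p_inject u n t \<le> p_capacity I n \<and>
        0 \<le> q_inject u n t \<and> q_inject u n t \<le> q_capacity I n) \<and>
     (\<forall>n \<in> nodes I - substations I.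
        0 \<le> p_inject u n t \<and> p_inject u n t \<le> place g n * p_capacity I n \<and>
        0 \<le> q_inject u n t \<and> q_inject u n t \<le> place g n * q_capacity I n) \<and>
     (\<forall>n\<in>nodes I. 0 \<le> shed u n t \<and> shed u n t \<le> p_load I n t)}"

definition total_shed :: "'n planning \<Rightarrow> 'n second_stage \<Rightarrow> real" where
  "total_shed I u = (\<Sum>t\<in>periods I. \<Sum>n\<in>nodes I. shed u n t)"

definition recourse :: "'n planning \<Rightarrow> 'n first_stage \<Rightarrow> 'n scenario \<Rightarrow> real" where
  "recourse I g z = Inf (total_shed I ` second_stage_set I g z)"

definition second_stage_optimal ::
    "'n planning \<Rightarrow> 'n first_stage \<Rightarrow> 'n scenario \<Rightarrow> 'n second_stage \<Rightarrow> bool" where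
  "second_stage_optimal I g z u \<longleftrightarrow> u \<in> second_stage_set I g z \<and>
     (\<forall>u'\<in>second_stage_set I g z. total_shed I u \<le> total_shed I u')"

definition recourse_finite :: "'n planning \<Rightarrow> bool" where
  "recourse_finite I \<longleftrightarrow> (\<forall>g\<in>first_stage_set I. \<forall>z\<in>scenarios I.
     second_stage_set I g z \<noteq> {} \<and> bdd_below (total_shed I ` second_stage_set I g z))"

section \<open>Ambiguity set and worst-case distributions\<close>

definition ambiguity_set :: "'n planning \<Rightarrow> 'n scenario pmf set" where
  "ambiguity_set I = {P. set_pmf P \<subseteq> scenarios I \<and>
     (\<forall>e\<in>lines I. \<forall>t\<in>periods I.
        0 \<le> measure_pmf.expectation P (\<lambda>z. 1 - z (e, t)) \<and>
        measure_pmf.expectation P (\<lambda>z. 1 - z (e, t)) \<le> failure_rate I (e, t))}"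

definition expected_recourse :: "'n planning \<Rightarrow> 'n first_stage \<Rightarrow> 'n scenario pmf \<Rightarrow> real" where
  "expected_recourse I g P = measure_pmf.expectation P (recourse I g)"

definition worst_case_distribution ::
    "'n planning \<Rightarrow> 'n first_stage \<Rightarrow> 'n scenario pmf \<Rightarrow> bool" where
  "worst_case_distribution I g P \<longleftrightarrow> P \<in> ambiguity_set I \<and>
     (\<forall>P'\<in>ambiguity_set I. expected_recourse I g P' \<le> expected_recourse I g P)"

section \<open>Full problem, master problem, subproblem\<close>

type_synonym 'n multiplier = "('n \<times> 'n) \<times> nat \<Rightarrow> real"   \<comment> \<open>\<open>\<beta>\<close>\<close>

definition multipliers :: "'n planning \<Rightarrow> 'n multiplier set" where
  "multipliers I = {\<beta>. \<forall>e\<in>lines I. \<forall>t\<in>periods I. 0 \<le> \<beta> (e, t)}"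

definition full_objective :: "'n planning \<Rightarrow> 'n multiplier \<Rightarrow> 'n first_stage \<Rightarrow> real" where
  "full_objective I \<beta> g = (MAX z\<in>scenarios I. recourse I g z +
     (\<Sum>t\<in>periods I. \<Sum>e\<in>lines I. (failure_rate I (e, t) + z (e, t) - 1) * \<beta> (e, t)))"

definition base_cost :: "'n planning \<Rightarrow> 'n multiplier \<Rightarrow> real" where
  "base_cost I \<beta> = (\<Sum>t\<in>periods I. \<Sum>e\<in>lines I. (failure_rate I (e, t) - 1) * \<beta> (e, t))"

definition scenario_cost :: "'n planning \<Rightarrow> 'n multiplier \<Rightarrow> 'n scenario \<Rightarrow> real" where
  "scenario_cost I \<beta> z = (\<Sum>t\<in>periods I. \<Sum>e\<in>lines I. z (e, t) * \<beta> (e, t))"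

definition master_objective :: "'n planning \<Rightarrow> 'n multiplier \<Rightarrow> real \<Rightarrow> real" where
  "master_objective I \<beta> l = base_cost I \<beta> + l"

text \<open>Scenarios are numbered from 0: \<open>zs ! j\<close> and \<open>u j\<close> belong together for \<open>j < length zs\<close>.\<close>

definition master_feasible ::
    "'n planning \<Rightarrow> 'n scenario list \<Rightarrow> 'n multiplier \<Rightarrow> 'n first_stage \<Rightarrow> real \<Rightarrow>
     (nat \<Rightarrow> 'n second_stage) \<Rightarrow> bool" where
  "master_feasible I zs \<beta> g l u \<longleftrightarrow>
     \<beta> \<in> multipliers I \<and> g \<in> first_stage_set I \<and>
     (\<forall>j<length zs. u j \<in> second_stage_set I g (zs ! j) \<and>
        total_shed I (u j) + scenario_cost I \<beta> (zs ! j) \<le> l)"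

definition master_optimal ::
    "'n planning \<Rightarrow> 'n scenario list \<Rightarrow> 'n multiplier \<Rightarrow> 'n first_stage \<Rightarrow> real \<Rightarrow>
     (nat \<Rightarrow> 'n second_stage) \<Rightarrow> bool" where
  "master_optimal I zs \<beta> g l u \<longleftrightarrow> master_feasible I zs \<beta> g l u \<and>
     (\<forall>\<beta>' g' l' u'. master_feasible I zs \<beta>' g' l' u' \<longrightarrow>
        master_objective I \<beta> l \<le> master_objective I \<beta>' l')"

definition master_unbounded :: "'n planning \<Rightarrow> 'n scenario list \<Rightarrow> bool" where
  "master_unbounded I zs \<longleftrightarrow>
     (\<forall>b. \<exists>\<beta> g l u. master_feasible I zs \<beta> g l u \<and> master_objective I \<beta> l < b)"

definition sub_objective ::
    "'n planning \<Rightarrow> 'n multiplier \<Rightarrow> 'n first_stage \<Rightarrow> 'n scenario \<Rightarrow> real" where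
  "sub_objective I \<beta> g z = recourse I g z + (\<Sum>t\<in>periods I. \<Sum>e\<in>lines I. \<beta> (e, t) * z (e, t))"

definition sub_optimal ::
    "'n planning \<Rightarrow> 'n multiplier \<Rightarrow> 'n first_stage \<Rightarrow> 'n scenario \<Rightarrow> bool" where
  "sub_optimal I \<beta> g z \<longleftrightarrow> z \<in> scenarios I \<and>
     (\<forall>z'\<in>scenarios I. sub_objective I \<beta> g z' \<le> sub_objective I \<beta> g z)"

section \<open>The column-and-constraint generation procedure\<close>

text \<open>One iteration, from the scenario list \<open>zs\<close> and upper bound \<open>UB\<close> to the new bounds \<open>LB\<close>,
  \<open>UB'\<close> and the scenario \<open>z\<close>. With no scenarios (hence in the first iteration), and possibly with
  few of them, the master problem is unbounded; then \<open>LB\<close> is minus infinity and the subproblem is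
  solved at some feasible point.\<close>

definition ccg_iteration ::
    "'n planning \<Rightarrow> 'n scenario list \<Rightarrow> ereal \<Rightarrow> 'n multiplier \<Rightarrow> 'n first_stage \<Rightarrow> real \<Rightarrow>
     (nat \<Rightarrow> 'n second_stage) \<Rightarrow> ereal \<Rightarrow> 'n scenario \<Rightarrow> ereal \<Rightarrow> bool" where
  "ccg_iteration I zs UB \<beta> g l u LB z UB' \<longleftrightarrow>
     (master_optimal I zs \<beta> g l u \<and> LB = ereal (master_objective I \<beta> l) \<or>
      master_unbounded I zs \<and> master_feasible I zs \<beta> g l u \<and> LB = -\<infinity>) \<and>
     sub_optimal I \<beta> g z \<and>
     UB' = min UB (ereal (sub_objective I \<beta> g z + base_cost I \<beta>))"

text \<open>The test \<open>(UB - LB) / LB \<le> \<epsilon>\<close>, for finite bounds. A finite \<open>LB\<close> is nonnegative; for \<open>LB = 0\<close>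
  the quotient is read as 0 if \<open>UB = 0\<close> and as infinite otherwise (note that \<open>x / 0 = 0\<close> in HOL).\<close>

definition gap_closed :: "real \<Rightarrow> ereal \<Rightarrow> ereal \<Rightarrow> bool" where
  "gap_closed \<epsilon> LB UB \<longleftrightarrow> (\<exists>a b. LB = ereal a \<and> UB = ereal b \<and>
     (if a = 0 then b = 0 else (b - a) / a \<le> \<epsilon>))"

text \<open>\<open>ccg_reaches I \<epsilon> zs UB\<close>: an iteration starts with scenario list \<open>zs\<close> and upper bound \<open>UB\<close>.
  The list is kept duplicate-free; a repeated scenario can only occur while the master
  problem is unbounded, since otherwise it closes the gap.\<close>

inductive ccg_reaches :: "'n planning \<Rightarrow> real \<Rightarrow> 'n scenario list \<Rightarrow> ereal \<Rightarrow> bool"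
  for I :: "'n planning" and \<epsilon> :: real where
  start: "ccg_reaches I \<epsilon> [] \<infinity>"
| step: "ccg_reaches I \<epsilon> zs UB \<Longrightarrow> ccg_iteration I zs UB \<beta> g l u LB z UB' \<Longrightarrow>
    \<not> gap_closed \<epsilon> LB UB' \<Longrightarrow>
    ccg_reaches I \<epsilon> (if z \<in> set zs then zs else zs @ [z]) UB'"

text \<open>The last master problem solved has the scenarios \<open>zs\<close> and the optimal solution
  \<open>(\<beta>, g, l, u)\<close>; \<open>LB\<close> and \<open>UB\<close> are the bounds on termination.\<close>

definition ccg_terminates ::
    "'n planning \<Rightarrow> real \<Rightarrow> 'n scenario list \<Rightarrow> 'n multiplier \<Rightarrow> 'n first_stage \<Rightarrow> real \<Rightarrow>
     (nat \<Rightarrow> 'n second_stage) \<Rightarrow> real \<Rightarrow> real \<Rightarrow> bool" where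
  "ccg_terminates I \<epsilon> zs \<beta> g l u LB UB \<longleftrightarrow>
     (\<exists>UB\<^sub>0 z. ccg_reaches I \<epsilon> zs UB\<^sub>0 \<and> ccg_iteration I zs UB\<^sub>0 \<beta> g l u (ereal LB) z (ereal UB) \<and>
        gap_closed \<epsilon> (ereal LB) (ereal UB))"

section \<open>Linear programs and their duals\<close>

text \<open>The linear program: minimize \<open>\<Sum>v\<in>V. c v * x v\<close> subject to
  \<open>(\<Sum>v\<in>V. A i v * x v) \<ge> b i\<close> for \<open>i \<in> C\<close> and \<open>x v \<ge> 0\<close> for \<open>v \<in> N\<close>; the variables in \<open>V - N\<close> are free.\<close>

definition lp_feasible ::
    "'v set \<Rightarrow> 'v set \<Rightarrow> 'c set \<Rightarrow> ('c \<Rightarrow> 'v \<Rightarrow> real) \<Rightarrow> ('c \<Rightarrow> real) \<Rightarrow> ('v \<Rightarrow> real) \<Rightarrow> bool" where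
  "lp_feasible V N C A b x \<longleftrightarrow>
     (\<forall>i\<in>C. b i \<le> (\<Sum>v\<in>V. A i v * x v)) \<and> (\<forall>v\<in>V \<inter> N. 0 \<le> x v)"

definition lp_dual_feasible ::
    "'v set \<Rightarrow> 'v set \<Rightarrow> 'c set \<Rightarrow> ('c \<Rightarrow> 'v \<Rightarrow> real) \<Rightarrow> ('v \<Rightarrow> real) \<Rightarrow> ('c \<Rightarrow> real) \<Rightarrow> bool" where
  "lp_dual_feasible V N C A c \<psi> \<longleftrightarrow>
     (\<forall>i\<in>C. 0 \<le> \<psi> i) \<and>
     (\<forall>v\<in>V \<inter> N. (\<Sum>i\<in>C. \<psi> i * A i v) \<le> c v) \<and>
     (\<forall>v\<in>V - N. (\<Sum>i\<in>C. \<psi> i * A i v) = c v)"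

definition lp_dual_optimal ::
    "'v set \<Rightarrow> 'v set \<Rightarrow> 'c set \<Rightarrow> ('c \<Rightarrow> 'v \<Rightarrow> real) \<Rightarrow> ('c \<Rightarrow> real) \<Rightarrow> ('v \<Rightarrow> real) \<Rightarrow>
     ('c \<Rightarrow> real) \<Rightarrow> bool" where
  "lp_dual_optimal V N C A b c \<psi> \<longleftrightarrow> lp_dual_feasible V N C A c \<psi> \<and>
     (\<forall>\<psi>'. lp_dual_feasible V N C A c \<psi>' \<longrightarrow> (\<Sum>i\<in>C. b i * \<psi>' i) \<le> (\<Sum>i\<in>C. b i * \<psi> i))"

text \<open>The master problem with \<open>g\<close> and \<open>u\<close> fixed. The variable \<open>None\<close> is \<open>\<lambda>\<close>, and \<open>Some (e, t)\<close> is
  \<open>\<beta> (e, t)\<close>.\<close>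

definition fixed_vars :: "'n planning \<Rightarrow> (('n \<times> 'n) \<times> nat) option set" where
  "fixed_vars I = insert None (Some ` (lines I \<times> periods I))"

definition fixed_coeff :: "'n scenario list \<Rightarrow> nat \<Rightarrow> (('n \<times> 'n) \<times> nat) option \<Rightarrow> real" where
  "fixed_coeff zs j v = (case v of None \<Rightarrow> 1 | Some i \<Rightarrow> - (zs ! j) i)"

definition fixed_cost :: "'n planning \<Rightarrow> (('n \<times> 'n) \<times> nat) option \<Rightarrow> real" where
  "fixed_cost I v = (case v of None \<Rightarrow> 1 | Some i \<Rightarrow> failure_rate I i - 1)"

definition fixed_dual_optimal ::
    "'n planning \<Rightarrow> 'n scenario list \<Rightarrow> (nat \<Rightarrow> 'n second_stage) \<Rightarrow> (nat \<Rightarrow> real) \<Rightarrow> bool" where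
  "fixed_dual_optimal I zs u \<psi> \<longleftrightarrow>
     lp_dual_optimal (fixed_vars I) (range Some) {..<length zs}
       (fixed_coeff zs) (\<lambda>j. total_shed I (u j)) (fixed_cost I) \<psi>"

lemma fixed_sum:
  assumes "finite (lines I)"
  shows "(\<Sum>v\<in>fixed_vars I. h v) =
    h None + (\<Sum>t\<in>periods I. \<Sum>e\<in>lines I. (h (Some (e, t)) :: real))"
proof -
  have fin: "finite (lines I \<times> periods I)"
    using assms by (simp add: periods_def)
  have "(\<Sum>v\<in>fixed_vars I. h v) = h None + (\<Sum>i\<in>lines I \<times> periods I. h (Some i))"
    unfolding fixed_vars_def using fin by (subst sum.insert) (auto simp: sum.reindex)
  also have "(\<Sum>i\<in>lines I \<times> periods I. h (Some i)) =
      (\<Sum>e\<in>lines I. \<Sum>t\<in>periods I. h (Some (e, t)))"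
    by (simp add: sum.cartesian_product case_prod_unfold)
  also have "\<dots> = (\<Sum>t\<in>periods I. \<Sum>e\<in>lines I. h (Some (e, t)))"
    by (rule sum.swap)
  finally show ?thesis .
qed

lemma fixed_lp_feasible_iff:
  assumes "finite (lines I)"
  shows "lp_feasible (fixed_vars I) (range Some) {..<length zs} (fixed_coeff zs)
      (\<lambda>j. total_shed I (u j)) (case_option l \<beta>) \<longleftrightarrow>
    \<beta> \<in> multipliers I \<and>
    (\<forall>j<length zs. total_shed I (u j) + scenario_cost I \<beta> (zs ! j) \<le> l)"
proof -
  have "(\<Sum>v\<in>fixed_vars I. fixed_coeff zs j v * case_option l \<beta> v) =
      l - scenario_cost I \<beta> (zs ! j)" for j
    by (simp add: fixed_sum[OF assms] fixed_coeff_def scenario_cost_def sum_negf)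
  moreover have "(\<forall>v\<in>fixed_vars I \<inter> range Some. 0 \<le> case_option l \<beta> v) \<longleftrightarrow> \<beta> \<in> multipliers I"
  proof -
    have "fixed_vars I \<inter> range Some = Some ` (lines I \<times> periods I)"
      by (auto simp: fixed_vars_def)
    then show ?thesis
      by (simp only:) (auto simp: multipliers_def)
  qed
  ultimately show ?thesis
    by (auto simp: lp_feasible_def le_diff_eq)
qed

lemma fixed_lp_objective:
  assumes "finite (lines I)"
  shows "(\<Sum>v\<in>fixed_vars I. fixed_cost I v * case_option l \<beta> v) = master_objective I \<beta> l"
  by (simp add: fixed_sum[OF assms] fixed_cost_def master_objective_def base_cost_def)

end

theory Submission
  imports Defs
begin

text \<open>Strong duality shows that the value \<open>LB\<close> of the last master problem is attained by dual
  weights \<open>\<psi>\<close> on its scenarios. Dual feasibility of \<open>\<psi>\<close> says exactly that \<open>\<psi>\<close> is a probability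
  distribution in the ambiguity set, and its dual value is the expected recourse when the shed
  loads are second-stage optimal. Weak duality for the full problem bounds the expected recourse of
  every distribution in the ambiguity set by \<open>UB\<close>.\<close>

section \<open>Linear programming duality\<close>

text \<open>Bartl's induction on the constraints: if a constraint \<open>k\<close> is needed, some \<open>x0\<close> violates only it
  (and the conclusion), and projecting along \<open>x0\<close> onto the hyperplane \<open>A k \<bullet> x = 0\<close> eliminates it.\<close>

lemma farkas:
  fixes A :: "'c \<Rightarrow> 'v \<Rightarrow> real"
  assumes "finite C" and "finite V"
    and "\<And>x. \<forall>i\<in>C. 0 \<le> (\<Sum>v\<in>V. A i v * x v) \<Longrightarrow> 0 \<le> (\<Sum>v\<in>V. c v * x v)"
  shows "\<exists>y. (\<forall>i\<in>C. 0 \<le> y i) \<and> (\<forall>v\<in>V. c v = (\<Sum>i\<in>C. y i * A i v))"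
  using assms(1,3)
proof (induction C arbitrary: A c)
  case empty
  \<comment> \<open>Without constraints the hypothesis applies to every \<open>x\<close>; the choice
    \<open>x = - c\<close> forces \<open>c\<close> to vanish on \<open>V\<close>.\<close>
  have "0 \<le> (\<Sum>v\<in>V. c v * - c v)"
    by (rule empty) simp
  then have "(\<Sum>v\<in>V. c v * c v) \<le> 0"
    by (simp add: sum_negf)
  then have "(\<Sum>v\<in>V. c v * c v) = 0"
    by (intro antisym sum_nonneg) auto
  then have "\<forall>v\<in>V. c v = 0"
    using \<open>finite V\<close> by (subst (asm) sum_nonneg_eq_0_iff) auto
  then show ?case
    by simp
next
  case (insert k C)
  define dot where "dot a x = (\<Sum>v\<in>V. a v * x v)" for a x :: "'v \<Rightarrow> real"
  show ?case
  proof (cases "\<forall>x. (\<forall>i\<in>C. 0 \<le> dot (A i) x) \<longrightarrow> 0 \<le> dot c x")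
    case True
    then obtain y where y: "\<forall>i\<in>C. 0 \<le> y i" "\<forall>v\<in>V. c v = (\<Sum>i\<in>C. y i * A i v)"
      using insert.IH[of A c] by (auto simp: dot_def)
    have "(\<Sum>i\<in>C. (y(k := 0)) i * A i v) = (\<Sum>i\<in>C. y i * A i v)" for v
      using insert.hyps by (intro sum.cong) auto
    then have "\<forall>v\<in>V. c v = (\<Sum>i\<in>insert k C. (y(k := 0)) i * A i v)"
      using y insert.hyps by simp
    moreover have "\<forall>i\<in>insert k C. 0 \<le> (y(k := 0)) i"
      using y by auto
    ultimately show ?thesis
      by blast
  next
    case False
    then obtain x0 where x0: "\<forall>i\<in>C. 0 \<le> dot (A i) x0" "dot c x0 < 0"
      by (auto simp: not_le)
    have neg: "dot (A k) x0 < 0"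
    proof (rule ccontr)
      assume "\<not> dot (A k) x0 < 0"
      then have "0 \<le> dot c x0"
        unfolding dot_def using x0(1) by (intro insert.prems) (auto simp: dot_def)
      then show False
        using x0(2) by simp
    qed
    \<comment> \<open>\<open>elim a\<close> is the functional \<open>a\<close> composed with the
      projection along \<open>x0\<close>, so it vanishes at \<open>x0\<close>;
      \<open>elim (A k)\<close> vanishes everywhere.\<close>
    define r where "r a = dot a x0 / dot (A k) x0" for a
    define elim where "elim a v = a v - r a * A k v" for a v
    have project: "dot a (\<lambda>v. x v - dot (A k) x / dot (A k) x0 * x0 v) = dot (elim a) x" for a x
    proof -
      have "dot a (\<lambda>v. x v - s * x0 v) = dot a x - s * dot a x0" for s
        by (simp add: dot_def algebra_simps sum_subtractf sum_distrib_left)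
      moreover have "dot (elim a) x = dot a x - r a * dot (A k) x"
        by (simp add: dot_def elim_def algebra_simps sum_subtractf sum_distrib_left)
      ultimately show ?thesis
        by (simp only: r_def) (simp add: mult.commute)
    qed
    have "elim (A k) v = 0" for v
      using neg by (simp add: elim_def r_def)
    then have elim_k: "dot (elim (A k)) x = 0" for x
      by (simp add: dot_def)
    have "\<exists>y. (\<forall>i\<in>C. 0 \<le> y i) \<and> (\<forall>v\<in>V. elim c v = (\<Sum>i\<in>C. y i * elim (A i) v))"
    proof (rule insert.IH)
      fix x assume "\<forall>i\<in>C. 0 \<le> (\<Sum>v\<in>V. elim (A i) v * x v)"
      then have "\<forall>i\<in>insert k C. 0 \<le> dot (elim (A i)) x"
        using elim_k by (simp add: dot_def)
      \<comment> \<open>The projection of \<open>x\<close> satisfies the constraints in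
        \<open>C\<close>, and constraint \<open>k\<close> with equality, so the original hypothesis
        applies to it.\<close>
      then have "0 \<le> dot c (\<lambda>v. x v - dot (A k) x / dot (A k) x0 * x0 v)"
        unfolding dot_def[of c] by (intro insert.prems) (simp only: project flip: dot_def)
      then show "0 \<le> (\<Sum>v\<in>V. elim c v * x v)"
        by (simp only: project flip: dot_def)
    qed
    then obtain y where y: "\<forall>i\<in>C. 0 \<le> y i"
      "\<forall>v\<in>V. elim c v = (\<Sum>i\<in>C. y i * elim (A i) v)"
      by blast
    \<comment> \<open>Undoing the elimination in the combination for \<open>elim c\<close> leaves
      exactly this multiple of \<open>A k\<close>. It is a quotient of two negative numbers, because
      \<open>x0\<close> makes \<open>c\<close> and \<open>A k\<close> negative and every other row
      nonnegative.\<close>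
    define s where "s = r c - (\<Sum>i\<in>C. y i * r (A i))"
    have "s = (dot c x0 - (\<Sum>i\<in>C. y i * dot (A i) x0)) / dot (A k) x0"
      by (simp add: s_def r_def diff_divide_distrib sum_divide_distrib)
    moreover have "0 \<le> (\<Sum>i\<in>C. y i * dot (A i) x0)"
      using x0 y by (intro sum_nonneg) auto
    ultimately have "0 \<le> s"
      using x0(2) neg by (simp add: zero_le_divide_iff)
    then have "\<forall>i\<in>insert k C. 0 \<le> (y(k := s)) i"
      using y by auto
    moreover have "c v = (\<Sum>i\<in>insert k C. (y(k := s)) i * A i v)" if "v \<in> V" for v
    proof -
      have "c v = r c * A k v + (\<Sum>i\<in>C. y i * elim (A i) v)"
        using y(2) that by (simp add: elim_def algebra_simps)
      also have "\<dots> = s * A k v + (\<Sum>i\<in>C. y i * A i v)"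
        by (simp add: s_def elim_def algebra_simps sum_subtractf sum_distrib_left)
      also have "(\<Sum>i\<in>C. y i * A i v) = (\<Sum>i\<in>C. (y(k := s)) i * A i v)"
        using insert.hyps by (intro sum.cong) auto
      finally show ?thesis
        using insert.hyps by simp
    qed
    ultimately show ?thesis
      by blast
  qed
qed

lemma lp_weak_duality:
  assumes "finite V" and primal: "lp_feasible V N C A b x"
    and dual: "lp_dual_feasible V N C A c \<psi>"
  shows "(\<Sum>i\<in>C. b i * \<psi> i) \<le> (\<Sum>v\<in>V. c v * x v)"
proof -
  have "(\<Sum>i\<in>C. b i * \<psi> i) \<le> (\<Sum>i\<in>C. (\<Sum>v\<in>V. A i v * x v) * \<psi> i)"
    using primal dual
    by (intro sum_mono mult_right_mono) (auto simp: lp_feasible_def lp_dual_feasible_def)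
  also have "\<dots> = (\<Sum>i\<in>C. \<Sum>v\<in>V. \<psi> i * A i v * x v)"
    by (simp add: sum_distrib_left sum_distrib_right mult_ac)
  also have "\<dots> = (\<Sum>v\<in>V. (\<Sum>i\<in>C. \<psi> i * A i v) * x v)"
    by (subst sum.swap) (simp add: sum_distrib_right)
  also have "\<dots> \<le> (\<Sum>v\<in>V. c v * x v)"
  \<comment> \<open>For \<open>v\<close> in \<open>N\<close> the dual inequality is multiplied by
    \<open>x v \<ge> 0\<close>; a free variable has no sign and relies on the dual equation.\<close>
  proof (rule sum_mono)
    fix v assume "v \<in> V"
    then show "(\<Sum>i\<in>C. \<psi> i * A i v) * x v \<le> c v * x v"
      using primal dual
      by (cases "v \<in> N") (auto simp: lp_feasible_def lp_dual_feasible_def intro!: mult_right_mono)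
  qed
  finally show ?thesis .
qed

text \<open>Farkas applied to the homogenized program turns a lower bound into a dual certificate.
  Any lower bound \<open>L\<close> serves in place of the optimal value, so no primal minimizer has
  to be produced.\<close>

lemma lp_strong_duality:
  fixes A :: "'c \<Rightarrow> 'v \<Rightarrow> real"
  assumes fin: "finite V" "finite C" and x0: "lp_feasible V N C A b x0"
    and bound: "\<And>x. lp_feasible V N C A b x \<Longrightarrow> L \<le> (\<Sum>v\<in>V. c v * x v)"
  shows "\<exists>\<psi>. lp_dual_feasible V N C A c \<psi> \<and> L \<le> (\<Sum>i\<in>C. b i * \<psi> i)"
proof -
  text \<open>Homogenize: the variable \<open>None\<close> scales the right-hand side, and the constraints \<open>Inr v\<close> are
    the sign constraints.\<close>
  define V' where "V' = insert None (Some ` V)"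
  define S where "S = insert None (Some ` (V \<inter> N))"
  define C' where "C' = C <+> S"
  define A' :: "'c + 'v option \<Rightarrow> 'v option \<Rightarrow> real" where
    "A' k w = (case k of Inl i \<Rightarrow> (case w of None \<Rightarrow> - b i | Some v \<Rightarrow> A i v)
      | Inr v \<Rightarrow> if v = w then 1 else 0)" for k w
  \<comment> \<open>With cost \<open>- L\<close> on the scaling variable, nonnegativity of the
    homogenized objective reads
    \<open>L * x None \<le> (\<Sum>v\<in>V. c v * x (Some v))\<close>.\<close>
  define c' where "c' w = (case w of None \<Rightarrow> - L | Some v \<Rightarrow> c v)" for w :: "'v option"
  have finS: "finite S" and finV': "finite V'" and finC': "finite C'" and "S \<subseteq> V'"
    using fin by (auto simp: S_def V'_def C'_def)
  have sumV': "(\<Sum>w\<in>V'. h w) = h None + (\<Sum>v\<in>V. h (Some v))" for h :: "'v option \<Rightarrow> real"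
    using fin(1) by (simp add: V'_def sum.reindex)
  have rows: "(\<Sum>w\<in>V'. A' (Inl i) w * x w) = (\<Sum>v\<in>V. A i v * x (Some v)) - b i * x None" for i x
    by (simp add: sumV' A'_def)
  have signs: "(\<Sum>w\<in>V'. A' (Inr v) w * x w) = x v" if "v \<in> S" for v x
  proof -
    have "(\<Sum>w\<in>V'. A' (Inr v) w * x w) = (\<Sum>w\<in>V'. if v = w then x w else 0)"
      by (rule sum.cong) (auto simp: A'_def)
    also have "\<dots> = x v"
      using that finV' \<open>S \<subseteq> V'\<close> by (auto simp: sum.delta)
    finally show ?thesis .
  qed
  have "\<exists>y. (\<forall>k\<in>C'. 0 \<le> y k) \<and> (\<forall>w\<in>V'. c' w = (\<Sum>k\<in>C'. y k * A' k w))"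
  proof (rule farkas[OF finC' finV'])
    fix x assume hom: "\<forall>k\<in>C'. 0 \<le> (\<Sum>w\<in>V'. A' k w * x w)"
    have row: "b i * x None \<le> (\<Sum>v\<in>V. A i v * x (Some v))" if "i \<in> C" for i
      using hom that by (force simp: C'_def rows)
    have sign: "0 \<le> x v" if "v \<in> S" for v
    proof -
      have "Inr v \<in> C'"
        using that by (auto simp: C'_def)
      then show ?thesis
        using hom signs[OF that, of x] by fastforce
    qed
    have "L * x None \<le> (\<Sum>v\<in>V. c v * x (Some v))"
    proof (cases "x None = 0")
      case True
      \<comment> \<open>Here \<open>x\<close> is a recession direction: \<open>x0\<close> plus any
        nonnegative multiple of it stays feasible, so a negative slope \<open>d\<close> would push
        the cost below \<open>L\<close>.\<close>
      define d where "d = (\<Sum>v\<in>V. c v * x (Some v))"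
      have ray: "L \<le> (\<Sum>v\<in>V. c v * x0 v) + k * d" if "0 \<le> k" for k
      proof -
        have expand: "(\<Sum>v\<in>V. a v * (x0 v + k * x (Some v))) =
            (\<Sum>v\<in>V. a v * x0 v) + k * (\<Sum>v\<in>V. a v * x (Some v))" for a
          by (simp add: algebra_simps sum.distrib sum_distrib_left)
        have "lp_feasible V N C A b (\<lambda>v. x0 v + k * x (Some v))"
          unfolding lp_feasible_def expand
        proof (intro conjI ballI)
          fix i assume i: "i \<in> C"
          have "0 \<le> k * (\<Sum>v\<in>V. A i v * x (Some v))"
            using row[OF i] True that by simp
          then show "b i \<le> (\<Sum>v\<in>V. A i v * x0 v) + k * (\<Sum>v\<in>V. A i v * x (Some v))"
            using x0 i by (force simp: lp_feasible_def)
        next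
          fix v assume "v \<in> V \<inter> N"
          then show "0 \<le> x0 v + k * x (Some v)"
            using x0 sign[of "Some v"] that by (auto simp: lp_feasible_def S_def)
        qed
        from bound[OF this] show ?thesis
          by (simp add: expand d_def)
      qed
      have "0 \<le> d"
      proof (rule ccontr)
        assume "\<not> 0 \<le> d"
        \<comment> \<open>The step length at which the cost along the ray is exactly
          \<open>L - 1\<close>.\<close>
        define k where "k = ((\<Sum>v\<in>V. c v * x0 v) - L + 1) / - d"
        have "0 \<le> k"
          using ray[of 0] \<open>\<not> 0 \<le> d\<close> by (simp add: k_def divide_nonneg_neg)
        moreover have "k * d = - ((\<Sum>v\<in>V. c v * x0 v) - L + 1)"
          using \<open>\<not> 0 \<le> d\<close> by (simp add: k_def)
        ultimately show False
          using ray[of k] by simp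
      qed
      then show ?thesis
        using True by (simp add: d_def)
    next
      case False
      then have pos: "0 < x None"
        using sign[of None] by (simp add: S_def)
      have scale: "(\<Sum>v\<in>V. a v * (x (Some v) / x None)) = (\<Sum>v\<in>V. a v * x (Some v)) / x None" for a
        by (simp add: sum_divide_distrib)
      have "lp_feasible V N C A b (\<lambda>v. x (Some v) / x None)"
        unfolding lp_feasible_def scale
        using row sign pos by (auto simp: pos_le_divide_eq S_def)
      from bound[OF this] show ?thesis
        using pos by (simp add: scale pos_le_divide_eq del: times_divide_eq_right)
    qed
    then show "0 \<le> (\<Sum>w\<in>V'. c' w * x w)"
      by (simp add: sumV' c'_def)
  qed
  then obtain y where y: "\<forall>k\<in>C'. 0 \<le> y k" "\<forall>w\<in>V'. c' w = (\<Sum>k\<in>C'. y k * A' k w)"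
    by blast
  \<comment> \<open>Column \<open>w\<close> of the certificate. A sign constraint occurs only in the
    column of its own variable, so its multiplier is the slack of the dual constraint.\<close>
  have comb: "c' w = (\<Sum>i\<in>C. y (Inl i) * A' (Inl i) w) + (if w \<in> S then y (Inr w) else 0)"
    if "w \<in> V'" for w
  proof -
    have "(\<Sum>v\<in>S. y (Inr v) * A' (Inr v) w) = (\<Sum>v\<in>S. if v = w then y (Inr v) else 0)"
      by (rule sum.cong) (auto simp: A'_def)
    also have "\<dots> = (if w \<in> S then y (Inr w) else 0)"
      using finS by (simp add: sum.delta')
    finally show ?thesis
      using y(2) that fin(2) finS by (simp add: C'_def sum.Plus)
  qed
  define \<psi> where "\<psi> i = y (Inl i)" for i
  have yS: "0 \<le> y (Inr w)" if "w \<in> S" for w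
    using y(1) that by (auto simp: C'_def)
  have costs: "c v = (\<Sum>i\<in>C. \<psi> i * A i v) + (if v \<in> N then y (Inr (Some v)) else 0)" if "v \<in> V" for v
    using comb[of "Some v"] that by (auto simp: V'_def S_def c'_def A'_def \<psi>_def)
  have "lp_dual_feasible V N C A c \<psi>"
    unfolding lp_dual_feasible_def
    using y(1) costs yS by (auto simp: \<psi>_def C'_def S_def)
  \<comment> \<open>Column \<open>None\<close> says that \<open>L\<close> is the dual value minus
    the nonnegative multiplier of \<open>Inr None\<close>.\<close>
  moreover have "L \<le> (\<Sum>i\<in>C. b i * \<psi> i)"
    using comb[of None] yS[of None]
    by (simp add: V'_def S_def c'_def A'_def \<psi>_def sum_negf mult.commute)
  ultimately show ?thesis
    by blast
qed

section \<open>Finitely supported distributions\<close>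

text \<open>The distribution is the image of a distribution on indices under \<open>(!) xs\<close>.
  Distinct entries keep the weights of different indices from adding up at one point.\<close>

lemma pmf_of_weights:
  fixes w :: "nat \<Rightarrow> real"
  assumes "distinct xs" and nonneg: "\<forall>j<length xs. 0 \<le> w j" and total: "(\<Sum>j<length xs. w j) = 1"
  obtains P where "set_pmf P \<subseteq> set xs" "\<forall>j<length xs. pmf P (xs ! j) = w j"
    "\<And>f :: 'a \<Rightarrow> real. measure_pmf.expectation P f = (\<Sum>j<length xs. w j * f (xs ! j))"
proof -
  \<comment> \<open>\<open>embed_pmf\<close> takes a density on all of \<open>nat\<close>, so the
    weights are set to 0 beyond the list.\<close>
  define w' where "w' j = (if j < length xs then w j else 0)" for j
  have nonneg': "0 \<le> w' j" for j
    using nonneg by (simp add: w'_def)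
  have "(\<integral>\<^sup>+ j. ennreal (w' j) \<partial>count_space UNIV) = (\<Sum>j<length xs. ennreal (w' j))"
    by (rule nn_integral_count_space') (auto simp: w'_def)
  also have "\<dots> = ennreal (\<Sum>j<length xs. w' j)"
    using nonneg' by (intro sum_ennreal) auto
  also have "\<dots> = 1"
    using total by (simp add: w'_def)
  finally have prob: "(\<integral>\<^sup>+ j. ennreal (w' j) \<partial>count_space UNIV) = 1" .
  define Q where "Q = embed_pmf w'"
  have pmfQ: "pmf Q j = w' j" for j
    unfolding Q_def by (rule pmf_embed_pmf[OF nonneg' prob])
  have setQ: "set_pmf Q \<subseteq> {..<length xs}"
    by (auto simp: set_pmf_iff pmfQ w'_def split: if_splits)
  define P where "P = map_pmf ((!) xs) Q"
  have "set_pmf P \<subseteq> set xs"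
    using setQ by (auto simp: P_def)
  moreover have expect: "measure_pmf.expectation P f = (\<Sum>j<length xs. w j * f (xs ! j))"
    for f :: "'a \<Rightarrow> real"
  proof -
    have "measure_pmf.expectation P f = (\<Sum>j<length xs. pmf Q j *\<^sub>R f (xs ! j))"
      unfolding P_def integral_map_pmf using setQ by (intro integral_measure_pmf) auto
    then show ?thesis
      by (simp add: pmfQ w'_def)
  qed
  moreover have "pmf P (xs ! j) = w j" if "j < length xs" for j
  proof -
    have "pmf P (xs ! j) = measure_pmf.expectation P (indicator {xs ! j})"
      by (simp add: measure_pmf_single)
    also have "\<dots> = (\<Sum>i<length xs. if i = j then w i else 0)"
      unfolding expect using that \<open>distinct xs\<close>
      by (intro sum.cong) (auto simp: indicator_def nth_eq_iff_index_eq)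
    also have "\<dots> = w j"
      using that by (simp add: sum.delta')
    finally show ?thesis .
  qed
  ultimately show thesis
    using that by blast
qed

section \<open>The scenarios of the procedure\<close>

lemma valid_planning_finite:
  assumes "valid_planning I"
  shows "finite (nodes I)" "finite (lines I)" "finite (periods I)" "finite (scenarios I)"
proof -
  show "finite (nodes I)"
    using assms by (simp add: valid_planning_def)
  then show lines: "finite (lines I)"
    using assms finite_subset[of "lines I" "nodes I \<times> nodes I"] by (auto simp: valid_planning_def)
  show periods: "finite (periods I)"
    by (simp add: periods_def)
  have "finite ((lines I \<times> periods I) \<rightarrow>\<^sub>E {0, 1 :: real})"
    using lines periods by (intro finite_PiE) auto
  then show "finite (scenarios I)"
    by (rule rev_finite_subset) (auto simp: scenarios_def)
qed

lemma scenario_le_1: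
  assumes "z \<in> scenarios I" "e \<in> lines I" "t \<in> periods I"
  shows "z (e, t) \<le> 1"
proof -
  have "z (e, t) \<in> {0, 1}"
    using assms by (auto simp: scenarios_def PiE_iff)
  then show ?thesis
    by auto
qed

text \<open>Distinctness comes from the membership test in \<open>step\<close>; it is what allows
  one dual weight to be the probability of one scenario.\<close>

lemma ccg_reaches_scenarios:
  assumes "ccg_reaches I \<epsilon> zs UB"
  shows "distinct zs" "set zs \<subseteq> scenarios I"
  using assms by (induction, auto simp: ccg_iteration_def sub_optimal_def)

section \<open>Bounds on the expected recourse\<close>

text \<open>Weak duality for the full problem: averaging the inner maximum under \<open>P\<close>.\<close>

lemma expected_recourse_le_full_objective:
  assumes valid: "valid_planning I" and "\<beta> \<in> multipliers I" and P: "P \<in> ambiguity_set I"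
  shows "expected_recourse I g P \<le> full_objective I \<beta> g"
proof -
  define penalty where
    "penalty z = (\<Sum>t\<in>periods I. \<Sum>e\<in>lines I. (failure_rate I (e, t) + z (e, t) - 1) * \<beta> (e, t))" for z
  have supp: "set_pmf P \<subseteq> scenarios I"
    using P by (simp add: ambiguity_set_def)
  have int: "integrable (measure_pmf P) f" for f :: "_ \<Rightarrow> real"
    using supp valid_planning_finite[OF valid] by (intro integrable_measure_pmf_finite) (metis finite_subset)
  have "measure_pmf.expectation P penalty = (\<Sum>t\<in>periods I. \<Sum>e\<in>lines I.
      (failure_rate I (e, t) - measure_pmf.expectation P (\<lambda>z. 1 - z (e, t))) * \<beta> (e, t))"
    unfolding penalty_def using int by (simp add: Bochner_Integration.integral_sum diff_diff_eq2)
  also have "0 \<le> \<dots>"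
    using P \<open>\<beta> \<in> multipliers I\<close>
    by (intro sum_nonneg mult_nonneg_nonneg) (auto simp: ambiguity_set_def multipliers_def)
  finally have "expected_recourse I g P \<le> measure_pmf.expectation P (\<lambda>z. recourse I g z + penalty z)"
    using int by (simp add: expected_recourse_def)
  also have "\<dots> \<le> measure_pmf.expectation P (\<lambda>_. full_objective I \<beta> g)"
  proof (rule integral_mono_AE[OF int int], rule AE_pmfI)
    fix z assume "z \<in> set_pmf P"
    then show "recourse I g z + penalty z \<le> full_objective I \<beta> g"
      using supp valid_planning_finite[OF valid]
      by (auto simp: full_objective_def penalty_def intro!: Max_ge)
  qed
  finally show ?thesis
    by simp
qed

text \<open>The dual constraints of \<open>\<lambda>\<close> and \<open>\<beta>\<close> are the normalization and the moment bounds.\<close>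

lemma fixed_dual_feasible_distribution:
  assumes valid: "valid_planning I" and "distinct zs" and zs: "set zs \<subseteq> scenarios I"
    and dual: "lp_dual_feasible (fixed_vars I) (range Some) {..<length zs}
      (fixed_coeff zs) (fixed_cost I) \<psi>"
  obtains P where "P \<in> ambiguity_set I" "\<forall>j<length zs. pmf P (zs ! j) = \<psi> j"
    "expected_recourse I g P = (\<Sum>j<length zs. \<psi> j * recourse I g (zs ! j))"
proof -
  have nonneg: "\<forall>j<length zs. 0 \<le> \<psi> j"
    using dual by (simp add: lp_dual_feasible_def)
  have total: "(\<Sum>j<length zs. \<psi> j) = 1"
  proof -
    have "None \<in> fixed_vars I - range Some"
      by (auto simp: fixed_vars_def)
    then have "(\<Sum>j<length zs. \<psi> j * fixed_coeff zs j None) = fixed_cost I None"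
      using dual unfolding lp_dual_feasible_def by blast
    then show ?thesis
      by (simp add: fixed_coeff_def fixed_cost_def)
  qed
  obtain P where P: "set_pmf P \<subseteq> set zs" "\<forall>j<length zs. pmf P (zs ! j) = \<psi> j"
    "\<And>f :: _ \<Rightarrow> real. measure_pmf.expectation P f = (\<Sum>j<length zs. \<psi> j * f (zs ! j))"
    by (rule pmf_of_weights[OF \<open>distinct zs\<close> nonneg total]) (rule that; blast)
  have "0 \<le> measure_pmf.expectation P (\<lambda>z. 1 - z (e, t)) \<and>
      measure_pmf.expectation P (\<lambda>z. 1 - z (e, t)) \<le> failure_rate I (e, t)"
    if et: "e \<in> lines I" "t \<in> periods I" for e t
  proof
    have "z (e, t) \<le> 1" if "z \<in> set zs" for z
      using scenario_le_1[OF _ et] zs that by blast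
    then show "0 \<le> measure_pmf.expectation P (\<lambda>z. 1 - z (e, t))"
      unfolding P(3) using nonneg by (intro sum_nonneg mult_nonneg_nonneg) auto
    have "Some (e, t) \<in> fixed_vars I \<inter> range Some"
      using et by (auto simp: fixed_vars_def)
    then have "(\<Sum>j<length zs. \<psi> j * fixed_coeff zs j (Some (e, t))) \<le> fixed_cost I (Some (e, t))"
      using dual unfolding lp_dual_feasible_def by blast
    then have "1 - failure_rate I (e, t) \<le> (\<Sum>j<length zs. \<psi> j * (zs ! j) (e, t))"
      by (simp add: fixed_coeff_def fixed_cost_def sum_negf)
    then show "measure_pmf.expectation P (\<lambda>z. 1 - z (e, t)) \<le> failure_rate I (e, t)"
      unfolding P(3) by (simp add: algebra_simps sum_subtractf total)
  qed
  then have "P \<in> ambiguity_set I"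
    using P(1) zs by (auto simp: ambiguity_set_def)
  then show thesis
    using that P(2,3) by (simp add: expected_recourse_def)
qed

text \<open>Fixing \<open>g\<close> and replacing the shed loads by arbitrarily good ones does not change the value of
  the master problem, even if the infimum defining the recourse is not attained.\<close>

lemma master_optimal_le_recourse_bound:
  assumes "recourse_finite I" and zs: "set zs \<subseteq> scenarios I"
    and opt: "master_optimal I zs \<beta> g l u"
    and "\<beta>' \<in> multipliers I"
    and bound: "\<forall>j<length zs. recourse I g (zs ! j) + scenario_cost I \<beta>' (zs ! j) \<le> l'"
  shows "master_objective I \<beta> l \<le> master_objective I \<beta>' l'"
proof (rule field_le_epsilon)
  fix \<delta> :: real assume "0 < \<delta>"
  have g: "g \<in> first_stage_set I"
    using opt by (simp add: master_optimal_def master_feasible_def)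
  have "\<exists>v\<in>second_stage_set I g (zs ! j). total_shed I v < recourse I g (zs ! j) + \<delta>"
    if "j < length zs" for j
  proof -
    have "zs ! j \<in> scenarios I"
      using that zs nth_mem by blast
    then have "total_shed I ` second_stage_set I g (zs ! j) \<noteq> {}"
      using assms(1) g by (auto simp: recourse_finite_def)
    from cInf_lessD[OF this, of "recourse I g (zs ! j) + \<delta>"] show ?thesis
      using \<open>0 < \<delta>\<close> by (auto simp: recourse_def)
  qed
  then obtain u' where u': "\<And>j. j < length zs \<Longrightarrow> u' j \<in> second_stage_set I g (zs ! j) \<and>
      total_shed I (u' j) < recourse I g (zs ! j) + \<delta>"
    by metis
  have "master_feasible I zs \<beta>' g (l' + \<delta>) u'"
    unfolding master_feasible_def using assms(4) g u' bound by (smt (verit))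
  then have "master_objective I \<beta> l \<le> master_objective I \<beta>' (l' + \<delta>)"
    using opt by (auto simp: master_optimal_def)
  then show "master_objective I \<beta> l \<le> master_objective I \<beta>' l' + \<delta>"
    by (simp add: master_objective_def)
qed

section \<open>Shed loads against recourse values, and duality with the first stage fixed\<close>

lemma recourse_le_total_shed:
  assumes "recourse_finite I" "g \<in> first_stage_set I" "z \<in> scenarios I" "v \<in> second_stage_set I g z"
  shows "recourse I g z \<le> total_shed I v"
  using assms by (auto simp: recourse_def recourse_finite_def intro!: cInf_lower)

lemma recourse_eq_total_shed:
  assumes "second_stage_optimal I g z v"
  shows "recourse I g z = total_shed I v"
  unfolding recourse_def
  using assms by (intro cInf_eq_minimum) (auto simp: second_stage_optimal_def)

lemma total_shed_nonneg:
  assumes "v \<in> second_stage_set I g z"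
  shows "0 \<le> total_shed I v"
  unfolding total_shed_def
  using assms by (intro sum_nonneg) (auto simp: second_stage_set_def)

text \<open>A feasible point of the master problem, with its own \<open>g\<close> and
  \<open>u\<close> held fixed, is a feasible point of the linear program with the same
  objective.\<close>

lemma fixed_weak_duality:
  assumes "valid_planning I" and "master_feasible I zs \<beta> g l u"
    and "lp_dual_feasible (fixed_vars I) (range Some) {..<length zs}
      (fixed_coeff zs) (fixed_cost I) \<psi>"
  shows "(\<Sum>j<length zs. total_shed I (u j) * \<psi> j) \<le> master_objective I \<beta> l"
proof -
  note fin = valid_planning_finite[OF assms(1)]
  have "finite (fixed_vars I)"
    using fin by (simp add: fixed_vars_def)
  moreover have "lp_feasible (fixed_vars I) (range Some) {..<length zs} (fixed_coeff zs)
      (\<lambda>j. total_shed I (u j)) (case_option l \<beta>)"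
    using assms(2) by (simp add: fixed_lp_feasible_iff[OF fin(2)] master_feasible_def)
  ultimately show ?thesis
    using lp_weak_duality[OF _ _ assms(3)] by (simp flip: fixed_lp_objective[OF fin(2)])
qed

text \<open>The weights come from the linear program whose right-hand sides are the recourse values instead
  of the shed loads; they are optimal for both programs, as both have the value of the master problem.\<close>

lemma fixed_dual_optimal_exists:
  assumes valid: "valid_planning I" and rf: "recourse_finite I" and zs: "set zs \<subseteq> scenarios I"
    and opt: "master_optimal I zs \<beta> g l u"
  obtains \<psi> where "fixed_dual_optimal I zs u \<psi>"
    "master_objective I \<beta> l \<le> (\<Sum>j<length zs. \<psi> j * recourse I g (zs ! j))"
proof -
  let ?V = "fixed_vars I" and ?N = "range Some" and ?C = "{..<length zs}"
  note fin = valid_planning_finite[OF valid]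
  have finV: "finite ?V"
    using fin by (simp add: fixed_vars_def)
  have feas: "master_feasible I zs \<beta> g l u"
    using opt by (simp add: master_optimal_def)
  have le: "recourse I g (zs ! j) \<le> total_shed I (u j)" if "j < length zs" for j
    using feas that rf zs by (intro recourse_le_total_shed) (auto simp: master_feasible_def)
  have x0: "lp_feasible ?V ?N ?C (fixed_coeff zs) (\<lambda>j. total_shed I (u j)) (case_option l \<beta>)"
    using feas by (simp add: fixed_lp_feasible_iff[OF fin(2)] master_feasible_def)
  then have x0': "lp_feasible ?V ?N ?C (fixed_coeff zs) (\<lambda>j. recourse I g (zs ! j)) (case_option l \<beta>)"
    unfolding lp_feasible_def by (blast intro: order_trans[OF le])
  have "master_objective I \<beta> l \<le> (\<Sum>v\<in>?V. fixed_cost I v * x v)"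
    if x: "lp_feasible ?V ?N ?C (fixed_coeff zs) (\<lambda>j. recourse I g (zs ! j)) x" for x
  proof -
    \<comment> \<open>A point of the linear program decodes into multipliers \<open>\<beta>'\<close>
      and the value \<open>x None\<close> of \<open>\<lambda>\<close>, to which the bound for the
      master problem applies.\<close>
    define \<beta>' where "\<beta>' i = x (Some i)" for i
    have x_eq: "x = case_option (x None) \<beta>'"
      by (auto simp: \<beta>'_def split: option.split)
    have "recourse I g (zs ! j) \<le> x None - scenario_cost I \<beta>' (zs ! j)" if "j < length zs" for j
    proof -
      have "recourse I g (zs ! j) \<le> (\<Sum>v\<in>?V. fixed_coeff zs j v * x v)"
        using x that by (simp add: lp_feasible_def)
      also have "\<dots> = x None - scenario_cost I \<beta>' (zs ! j)"
        by (simp add: fixed_sum[OF fin(2)] fixed_coeff_def scenario_cost_def sum_negf \<beta>'_def)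
      finally show ?thesis .
    qed
    moreover have "\<beta>' \<in> multipliers I"
      using x by (auto simp: lp_feasible_def multipliers_def \<beta>'_def fixed_vars_def)
    ultimately have "master_objective I \<beta> l \<le> master_objective I \<beta>' (x None)"
      by (intro master_optimal_le_recourse_bound[OF rf zs opt]) (auto simp: le_diff_eq)
    then show ?thesis
      by (subst x_eq) (simp add: fixed_lp_objective[OF fin(2)])
  qed
  from lp_strong_duality[OF finV finite_lessThan x0' this]
  obtain \<psi> where \<psi>: "lp_dual_feasible ?V ?N ?C (fixed_coeff zs) (fixed_cost I) \<psi>"
    "master_objective I \<beta> l \<le> (\<Sum>j<length zs. recourse I g (zs ! j) * \<psi> j)"
    by blast
  note \<psi>(2)
  also have "(\<Sum>j<length zs. recourse I g (zs ! j) * \<psi> j) \<le> (\<Sum>j<length zs. total_shed I (u j) * \<psi> j)"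
    using \<psi>(1) le by (intro sum_mono mult_right_mono) (auto simp: lp_dual_feasible_def)
  \<comment> \<open>The weights reach the master value, which weak duality makes an upper bound for
    all competing dual values.\<close>
  finally have "fixed_dual_optimal I zs u \<psi>"
    unfolding fixed_dual_optimal_def lp_dual_optimal_def
    using \<psi>(1) fixed_weak_duality[OF valid feas] by (meson order_trans)
  then show thesis
    using that \<psi>(2) by (simp add: mult.commute)
qed

text \<open>\<open>UB\<close> is a minimum over all iterations and may stem from a first stage other
  than the output \<open>g\<close>; \<open>output_attains_bound\<close> ties it to \<open>g\<close>.
  The master problem does not force \<open>u j\<close> to be second-stage optimal, so a dual value
  may exceed the expected recourse: the claim for every \<open>\<psi>\<close> assumes optimality
  where the weight is positive, while some \<open>\<psi>\<close> works without it. A positive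
  tolerance leaves an error of \<open>UB - LB\<close>.\<close>

theorem proposition2:
  fixes I :: "'n planning"
    and \<epsilon> LB UB lam :: real
    and zs :: "'n scenario list"
    and \<beta> :: "'n multiplier"
    and g :: "'n first_stage"
    and u :: "nat \<Rightarrow> 'n second_stage"
  assumes data: "valid_planning I"
    and finite_recourse: "recourse_finite I"
    and tolerance: "0 \<le> \<epsilon>"
    and terminates: "ccg_terminates I \<epsilon> zs \<beta> g lam u LB UB"
    and output_attains_bound: "\<exists>\<beta>'\<in>multipliers I. full_objective I \<beta>' g \<le> UB"
  shows
    "(\<forall>\<psi>. fixed_dual_optimal I zs u \<psi> \<longrightarrow>
        (\<exists>P\<in>ambiguity_set I.
           (\<forall>j<length zs. pmf P (zs ! j) = \<psi> j) \<and>
           ((\<forall>j<length zs. 0 < \<psi> j \<longrightarrow> second_stage_optimal I g (zs ! j) (u j)) \<longrightarrow>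
              (\<forall>P'\<in>ambiguity_set I. expected_recourse I g P' \<le> expected_recourse I g P + (UB - LB)) \<and>
              (\<epsilon> = 0 \<or> UB = LB \<longrightarrow> worst_case_distribution I g P)))) \<and>
     (\<exists>\<psi>. fixed_dual_optimal I zs u \<psi> \<and>
        (\<exists>P\<in>ambiguity_set I.
           (\<forall>j<length zs. pmf P (zs ! j) = \<psi> j) \<and>
           (\<forall>P'\<in>ambiguity_set I. expected_recourse I g P' \<le> expected_recourse I g P + (UB - LB)) \<and>
           (\<epsilon> = 0 \<or> UB = LB \<longrightarrow> worst_case_distribution I g P)))"
proof -
  from terminates obtain UB0 z where reach: "ccg_reaches I \<epsilon> zs UB0"
    and iter: "ccg_iteration I zs UB0 \<beta> g lam u (ereal LB) z (ereal UB)"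
    and gap: "gap_closed \<epsilon> (ereal LB) (ereal UB)"
    by (auto simp: ccg_terminates_def)
  note zs = ccg_reaches_scenarios[OF reach]
  \<comment> \<open>A real \<open>LB\<close> excludes the alternative of an unbounded master
    problem.\<close>
  have opt: "master_optimal I zs \<beta> g lam u" and LB: "LB = master_objective I \<beta> lam"
    using iter by (auto simp: ccg_iteration_def)
  then have u: "\<forall>j<length zs. u j \<in> second_stage_set I g (zs ! j)"
    and g: "g \<in> first_stage_set I"
    by (auto simp: master_optimal_def master_feasible_def)
  obtain \<psi>0 where \<psi>0: "fixed_dual_optimal I zs u \<psi>0"
    "LB \<le> (\<Sum>j<length zs. \<psi>0 j * recourse I g (zs ! j))"
    using fixed_dual_optimal_exists[OF data finite_recourse zs(2) opt] LB by metis
  have weight_nonneg: "0 \<le> \<psi> j" if "fixed_dual_optimal I zs u \<psi>" "j < length zs" for \<psi> j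
    using that by (simp add: fixed_dual_optimal_def lp_dual_optimal_def lp_dual_feasible_def)
  have dual_value: "LB \<le> (\<Sum>j<length zs. \<psi> j * total_shed I (u j))"
    if "fixed_dual_optimal I zs u \<psi>" for \<psi>
  proof -
    have "(\<Sum>j<length zs. \<psi>0 j * recourse I g (zs ! j)) \<le> (\<Sum>j<length zs. \<psi>0 j * total_shed I (u j))"
      using \<psi>0(1) u g zs(2) finite_recourse
      by (intro sum_mono mult_left_mono recourse_le_total_shed weight_nonneg) auto
    also have "\<dots> \<le> (\<Sum>j<length zs. \<psi> j * total_shed I (u j))"
      using \<psi>0(1) that by (simp add: fixed_dual_optimal_def lp_dual_optimal_def mult.commute)
    finally show ?thesis
      using \<psi>0(2) by simp
  qed
  \<comment> \<open>The sign of \<open>LB\<close> matters because the stopping test divides by it: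
    for \<open>\<epsilon> = 0\<close> a nonpositive quotient gives \<open>UB \<le> LB\<close> only
    if \<open>LB\<close> is positive, and \<open>gap_closed\<close> treats \<open>LB = 0\<close>
    separately.\<close>
  have "0 \<le> (\<Sum>j<length zs. total_shed I (u j) * \<psi>0 j)"
    using \<psi>0(1) u by (intro sum_nonneg mult_nonneg_nonneg total_shed_nonneg weight_nonneg) auto
  also have "\<dots> \<le> LB"
    using \<psi>0(1) fixed_weak_duality[OF data] opt
    by (auto simp: LB master_optimal_def fixed_dual_optimal_def lp_dual_optimal_def)
  finally have "0 \<le> LB" .
  then have closed: "UB \<le> LB" if "\<epsilon> = 0 \<or> UB = LB"
    using gap that by (auto simp: gap_closed_def divide_le_0_iff split: if_splits)
  obtain \<beta>' where "\<beta>' \<in> multipliers I" "full_objective I \<beta>' g \<le> UB"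
    using output_attains_bound by blast
  then have upper: "expected_recourse I g P \<le> UB" if "P \<in> ambiguity_set I" for P
    using expected_recourse_le_full_objective[OF data _ that] by (meson order_trans)
  \<comment> \<open>All expectations over the ambiguity set lie below \<open>UB\<close>, so one that
    reaches \<open>LB\<close> is maximal up to the gap.\<close>
  have worst: "(\<forall>P'\<in>ambiguity_set I. expected_recourse I g P' \<le> expected_recourse I g P + (UB - LB)) \<and>
      (\<epsilon> = 0 \<or> UB = LB \<longrightarrow> worst_case_distribution I g P)"
    if "P \<in> ambiguity_set I" "LB \<le> expected_recourse I g P" for P
    using upper closed that by (fastforce simp: worst_case_distribution_def)
  have dist: "\<exists>P\<in>ambiguity_set I. (\<forall>j<length zs. pmf P (zs ! j) = \<psi> j) \<and>
      expected_recourse I g P = (\<Sum>j<length zs. \<psi> j * recourse I g (zs ! j))"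
    if "fixed_dual_optimal I zs u \<psi>" for \<psi>
    using that by (auto simp: fixed_dual_optimal_def lp_dual_optimal_def
        intro: fixed_dual_feasible_distribution[OF data zs])
  show ?thesis
  proof (intro conjI allI impI)
    fix \<psi> assume \<psi>: "fixed_dual_optimal I zs u \<psi>"
    obtain P where P: "P \<in> ambiguity_set I" "\<forall>j<length zs. pmf P (zs ! j) = \<psi> j"
      "expected_recourse I g P = (\<Sum>j<length zs. \<psi> j * recourse I g (zs ! j))"
      using dist[OF \<psi>] by blast
    have "LB \<le> expected_recourse I g P"
      if tight: "\<forall>j<length zs. 0 < \<psi> j \<longrightarrow> second_stage_optimal I g (zs ! j) (u j)"
    proof -
      have "\<psi> j * recourse I g (zs ! j) = \<psi> j * total_shed I (u j)" if "j < length zs" for j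
      proof (cases "0 < \<psi> j")
        case True
        then show ?thesis
          using tight that recourse_eq_total_shed by metis
      next
        case False
        then show ?thesis
          using weight_nonneg[OF \<psi> that] by simp
      qed
      then have "expected_recourse I g P = (\<Sum>j<length zs. \<psi> j * total_shed I (u j))"
        unfolding P(3) by (intro sum.cong) auto
      then show ?thesis
        using dual_value[OF \<psi>] by simp
    qed
    then show "\<exists>P\<in>ambiguity_set I. (\<forall>j<length zs. pmf P (zs ! j) = \<psi> j) \<and>
        ((\<forall>j<length zs. 0 < \<psi> j \<longrightarrow> second_stage_optimal I g (zs ! j) (u j)) \<longrightarrow>
          (\<forall>P'\<in>ambiguity_set I. expected_recourse I g P' \<le> expected_recourse I g P + (UB - LB)) \<and>
          (\<epsilon> = 0 \<or> UB = LB \<longrightarrow> worst_case_distribution I g P))"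
      using P(1,2) worst by blast
  next
    \<comment> \<open>The witness \<open>\<psi>0\<close> reaches \<open>LB\<close> with recourse
      values instead of shed loads, so the optimality of \<open>u\<close> does not enter.\<close>
    obtain P where P: "P \<in> ambiguity_set I" "\<forall>j<length zs. pmf P (zs ! j) = \<psi>0 j"
      "expected_recourse I g P = (\<Sum>j<length zs. \<psi>0 j * recourse I g (zs ! j))"
      using dist[OF \<psi>0(1)] by blast
    then have "LB \<le> expected_recourse I g P"
      using \<psi>0(2) by simp
    then show "\<exists>\<psi>. fixed_dual_optimal I zs u \<psi> \<and> (\<exists>P\<in>ambiguity_set I.
        (\<forall>j<length zs. pmf P (zs ! j) = \<psi> j) \<and>
        (\<forall>P'\<in>ambiguity_set I. expected_recourse I g P' \<le> expected_recourse I g P + (UB - LB)) \<and>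
        (\<epsilon> = 0 \<or> UB = LB \<longrightarrow> worst_case_distribution I g P))"
      using \<psi>0(1) P(1,2) worst by blast
  qed
qed

end
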